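(* Let $f:\mathbb{R}^d\to[0,\infty)$ be an upper semi-continuous log-concave function with finite integral, containing the origin in the interior of its support. For $s>0$ put $$f_s(x)=\left(1+\frac{\log f(x)}{s}\right)_+^{s},\qquad x\in\mathbb{R}^d.$$ Denote by $A$ the set of all points in $\mathbb{R}^d$ that are not in the boundary of the support of $\mathcal{L}_\infty f$. Then, as $s\to\infty$, $$\mathcal{L}_s f_s\!\left(\frac{x}{s}\right)\to \mathcal{L}_\infty f(x)$$ locally uniformly on $A$.
   Context: The support of a non-negative function $f$ on $\mathbb{R}^d$ is $\operatorname{supp} f=\{x\in\mathbb{R}^d: f(x)>0\}$. A non-negative function on $\mathbb{R}^d$ is log-concave if its logarithm is concave on its support. Notation: $(a)_+=\max\{a,0\}$, and $\log 0=-\infty$, so $f_s(x)=0$ wherever $f(x)=0$. For $s>0$ the $s$-polar transform of a non-negative function $g$ is $$\mathcal{L}_s g(y)=\inf_{\{x: g(x)>0\}}\frac{(1-\langle x,y\rangle)_+^{s}}{g(x)},$$ and the polar (log-conjugate) of $f$ is $$\mathcal{L}_\infty f(y)=\inf_{\{x: f(x)>0\}}\frac{e^{-\langle x,y\rangle}}{f(x)}.$$ *)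

theory Defs
  imports "HOL-Analysis.Analysis"
begin

definition supp :: "('a \<Rightarrow> real) \<Rightarrow> 'a set" where
  "supp f = {x. f x > 0}"

text \<open>
  The library's \<^const>\<open>concave_on\<close> includes convexity of the set, so a log-concave function
  has convex support.
\<close>

definition logconcave :: "('a::real_vector \<Rightarrow> real) \<Rightarrow> bool" where
  "logconcave f \<longleftrightarrow> (\<forall>x. f x \<ge> 0) \<and> concave_on (supp f) (\<lambda>x. ln (f x))"

definition upper_semicontinuous :: "('a::topological_space \<Rightarrow> real) \<Rightarrow> bool" where
  "upper_semicontinuous f \<longleftrightarrow> (\<forall>c. open {x. f x < c})"

text \<open>
  Both transforms are real-valued. The infimum is taken over a set bounded below by 0, so it is
  the usual infimum whenever the support is nonempty; for the zero function, where
  the usual convention gives the value \<open>\<infinity>\<close>, the value here is unspecified.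
\<close>

definition s_polar :: "real \<Rightarrow> ('a::real_inner \<Rightarrow> real) \<Rightarrow> 'a \<Rightarrow> real" where
  "s_polar s g y = (INF x\<in>supp g. (max (1 - x \<bullet> y) 0) powr s / g x)"

definition log_polar :: "('a::real_inner \<Rightarrow> real) \<Rightarrow> 'a \<Rightarrow> real" where
  "log_polar f y = (INF x\<in>supp f. exp (- (x \<bullet> y)) / f x)"

text \<open>
  The case distinction implements \<open>log 0 = -\<infinity>\<close>, since \<^term>\<open>ln (0::real)\<close> is \<open>0\<close> in HOL.
\<close>

definition s_approx :: "real \<Rightarrow> ('a \<Rightarrow> real) \<Rightarrow> 'a \<Rightarrow> real" where
  "s_approx s f x = (if f x > 0 then (max (1 + ln (f x) / s) 0) powr s else 0)"

definition locally_uniform_limit ::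
  "'a::topological_space set \<Rightarrow> ('i \<Rightarrow> 'a \<Rightarrow> 'b::metric_space) \<Rightarrow> ('a \<Rightarrow> 'b) \<Rightarrow> 'i filter \<Rightarrow> bool" where
  "locally_uniform_limit A h l F \<longleftrightarrow>
     (\<forall>x\<in>A. \<exists>U. open U \<and> x \<in> U \<and> uniform_limit (U \<inter> A) h l F)"

end

theory Submission
  imports Defs
begin

text \<open>
  Write \<open>\<phi> = - ln f\<close> on \<^term>\<open>supp f\<close>, so that \<open>log_polar f z\<close> is the infimum of
  \<open>exp (\<phi> x - x \<bullet> z)\<close> over \<open>x \<in> supp f\<close>, while the rescaled \<open>s\<close>-polar at \<open>z\<close> is the infimum of
  \<open>((1 - x \<bullet> z / s)\<^sub>+ / (1 - \<phi> x / s))\<close> to the power \<open>s\<close> over the points with \<open>\<phi> x < s\<close>. For fixed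
  \<open>x\<close> the second expression tends to the first; the difficulty is the infimum over an unbounded
  set.

  From above, \<open>(1 - t / s)\<^sub>+\<close> to the power \<open>s\<close> is at most \<open>exp (- t)\<close>. Testing the infimum with one
  nearly optimal \<open>x\<close> thus bounds the \<open>s\<close>-polars near any point by a little more than the
  log-conjugate there (\<open>s_polar_scaled_locally_less\<close>).

  From below, let \<open>\<tau> = x \<bullet> z\<close>. The inequality \<open>1 + u \<le> exp u\<close> with \<open>u = (\<tau> - \<phi> x) / (s - \<tau>)\<close> shows
  that, for \<open>\<tau> < s\<close>, each term of the \<open>s\<close>-polar is at least \<open>exp ((\<phi> x - \<tau>) * s / (s - \<tau>))\<close>. If the
  log-conjugate is at least \<open>exp m\<close> on a whole ball of radius \<open>r\<close> about \<open>z\<close>, then \<open>\<phi> x - \<tau>\<close> is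
  not only at least \<open>m\<close>, but at least \<open>m + r * norm x\<close>. This linear gain absorbs the distortion
  by the factor \<open>s / (s - \<tau>)\<close>, whose deviation from 1 is also governed by \<open>norm x\<close>, and gives the
  same bound \<open>exp m\<close> for the \<open>s\<close>-polar at \<open>z\<close> once \<open>s\<close> exceeds an explicit threshold
  (\<open>s_polar_scaled_ge\<close>).

  Off the frontier of its support the log-conjugate is continuous: it vanishes outside, and inside
  it is the exponential of a finite concave function (\<open>isCont_log_polar\<close>). Continuity turns the two
  one-sided estimates into convergence that is uniform near each point, and compactness of closed
  balls makes the neighbourhoods independent of the tolerance (\<open>locally_uniform_limitI\<close>).
\<close>

section \<open>The log-conjugate\<close>

lemma log_polar_le:
  assumes "x \<in> supp f"
  shows "log_polar f y \<le> exp (- (x \<bullet> y)) / f x"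
  unfolding log_polar_def
proof (rule cINF_lower[OF _ assms])
  show "bdd_below ((\<lambda>x. exp (- (x \<bullet> y)) / f x) ` supp f)"
    by (rule bdd_belowI2[where m = 0]) (simp add: supp_def)
qed

lemma log_polar_nonneg:
  assumes "supp f \<noteq> {}"
  shows "0 \<le> log_polar f y"
  unfolding log_polar_def by (rule cINF_greatest[OF assms]) (simp add: supp_def)

text \<open>
  The logarithm of each function in the infimum is affine in the dual variable, and an infimum of
  affine functions is concave. The inequality is proved in exponential form because the infimum
  may vanish; this form also yields convexity of the support.
\<close>

lemma logconcave_log_polar:
  assumes "supp f \<noteq> {}"
  shows "logconcave (log_polar f)"
proof -
  let ?L = "log_polar f"
  have interp: "exp (u * ln (?L y) + v * ln (?L z)) \<le> ?L (u *\<^sub>R y + v *\<^sub>R z)"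
    if y: "y \<in> supp ?L" and z: "z \<in> supp ?L" and uv: "0 \<le> u" "0 \<le> v" "u + v = 1" for y z u v
    unfolding log_polar_def[of f "u *\<^sub>R y + v *\<^sub>R z"]
  proof (rule cINF_greatest[OF assms])
    fix x assume x: "x \<in> supp f"
    have fx: "f x > 0" using x by (simp add: supp_def)
    have bound: "ln (?L w) \<le> - (x \<bullet> w) - ln (f x)" if "w \<in> supp ?L" for w
    proof -
      have "ln (?L w) \<le> ln (exp (- (x \<bullet> w)) / f x)"
        using log_polar_le[OF x, of w] that by (simp add: supp_def)
      then show ?thesis using fx by (simp add: ln_div)
    qed
    have "u * ln (?L y) + v * ln (?L z)
        \<le> u * (- (x \<bullet> y) - ln (f x)) + v * (- (x \<bullet> z) - ln (f x))"
      by (intro add_mono mult_left_mono bound y z uv)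
    also have "\<dots> = - (x \<bullet> (u *\<^sub>R y + v *\<^sub>R z)) - (u + v) * ln (f x)"
      by (simp add: inner_add_right algebra_simps)
    finally have "exp (u * ln (?L y) + v * ln (?L z))
        \<le> exp (- (x \<bullet> (u *\<^sub>R y + v *\<^sub>R z)) - ln (f x))"
      using uv by simp
    then show "exp (u * ln (?L y) + v * ln (?L z))
        \<le> exp (- (x \<bullet> (u *\<^sub>R y + v *\<^sub>R z))) / f x"
      using fx by (simp add: exp_diff)
  qed
  have pos: "0 < ?L (u *\<^sub>R y + v *\<^sub>R z)"
    if "y \<in> supp ?L" "z \<in> supp ?L" "0 \<le> u" "0 \<le> v" "u + v = 1" for y z u v
    using interp[OF that] by (rule less_le_trans[OF exp_gt_zero])
  have "convex (supp ?L)"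
    using pos by (auto simp: convex_def supp_def)
  moreover have "u * ln (?L y) + v * ln (?L z) \<le> ln (?L (u *\<^sub>R y + v *\<^sub>R z))"
    if "y \<in> supp ?L" "z \<in> supp ?L" "0 \<le> u" "0 \<le> v" "u + v = 1" for y z u v
    using interp[OF that] pos[OF that] by (simp add: ln_ge_iff)
  ultimately show ?thesis
    unfolding logconcave_def concave_on_iff using log_polar_nonneg[OF assms] by blast
qed

text \<open>
  On the interior of its support, the log-conjugate is the exponential of a finite concave function
  on an open set of a finite-dimensional space; off the closure of the support it vanishes.
\<close>

lemma isCont_log_polar:
  fixes f :: "'a::euclidean_space \<Rightarrow> real"
  assumes ne: "supp f \<noteq> {}" and y: "y \<in> - frontier (supp (log_polar f))"
  shows "isCont (log_polar f) y"
proof (cases "y \<in> interior (supp (log_polar f))")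
  case True
  let ?I = "interior (supp (log_polar f))"
  have pos: "log_polar f z > 0" if "z \<in> ?I" for z
  proof -
    have "z \<in> supp (log_polar f)" using that interior_subset by blast
    then show ?thesis by (simp add: supp_def)
  qed
  have conc: "convex_on (supp (log_polar f)) (\<lambda>y. - ln (log_polar f y))"
    using logconcave_log_polar[OF ne] by (simp add: logconcave_def concave_on_def)
  then have "convex_on ?I (\<lambda>y. - ln (log_polar f y))"
    by (rule convex_on_subset[OF _ interior_subset])
       (use conc in \<open>simp add: convex_on_imp_convex convex_interior\<close>)
  then have cont: "continuous_on ?I (\<lambda>y. - ln (log_polar f y))"
    by (intro convex_on_continuous) auto
  have exp: "continuous_on ?I (\<lambda>y. exp (- (- ln (log_polar f y))))"
    by (rule continuous_on_exp, rule continuous_on_minus, rule cont)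
  have "continuous_on ?I (log_polar f)"
    by (rule continuous_on_eq[OF exp]) (simp only: minus_minus pos exp_ln)
  then show ?thesis using True by (simp add: continuous_on_eq_continuous_at)
next
  case False
  let ?E = "- closure (supp (log_polar f))"
  have "continuous_on ?E (log_polar f)"
  proof (rule continuous_on_eq[OF continuous_on_const])
    fix z assume "z \<in> ?E"
    then have "z \<notin> supp (log_polar f)" using closure_subset by blast
    then have "\<not> log_polar f z > 0" by (simp add: supp_def)
    then show "0 = log_polar f z" using log_polar_nonneg[OF ne, of z] by simp
  qed
  moreover have "open ?E" "y \<in> ?E" using y False by (simp_all add: frontier_def open_Compl)
  ultimately show ?thesis using continuous_on_eq_continuous_at by blast
qed

section \<open>Bounds for the rescaled s-polar\<close>

lemma supp_s_approx:
  assumes "s > 0"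
  shows "supp (s_approx s f) = {x \<in> supp f. - s < ln (f x)}"
proof -
  have "s_approx s f x > 0 \<longleftrightarrow> f x > 0 \<and> - s < ln (f x)" for x
    using assms by (cases "f x > 0") (auto simp: s_approx_def field_simps max_def)
  then show ?thesis by (auto simp: supp_def)
qed

lemma s_approx_eq:
  assumes "s > 0" "x \<in> supp (s_approx s f)"
  shows "s_approx s f x = (1 + ln (f x) / s) powr s"
proof -
  have "f x > 0" "- s < ln (f x)"
    using assms(2) unfolding supp_s_approx[OF assms(1)] by (simp_all add: supp_def)
  then show ?thesis using assms(1) by (simp add: s_approx_def field_simps max_def)
qed

lemma s_polar_le:
  assumes "x \<in> supp g"
  shows "s_polar s g y \<le> (max (1 - x \<bullet> y) 0) powr s / g x"
  unfolding s_polar_def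
proof (rule cINF_lower[OF _ assms])
  show "bdd_below ((\<lambda>x. (max (1 - x \<bullet> y) 0) powr s / g x) ` supp g)"
    by (rule bdd_belowI2[where m = 0]) (simp add: supp_def)
qed

lemma s_polar_nonneg:
  assumes "supp g \<noteq> {}"
  shows "0 \<le> s_polar s g y"
  unfolding s_polar_def by (rule cINF_greatest[OF assms]) (simp add: supp_def)

text \<open>
  A single test point bounds the infimum, and \<open>(1 - t / s)\<^sub>+\<close> to the power \<open>s\<close> is at most
  \<open>exp (- t)\<close>; the dual point then enters only through \<open>exp (- (x \<bullet> z))\<close>, which makes the estimate
  uniform for \<open>z\<close> near a given point.
\<close>

lemma s_polar_scaled_le:
  assumes s: "s > 0" and x: "x \<in> supp (s_approx s f)"
  shows "s_polar s (s_approx s f) (z /\<^sub>R s) \<le> exp (- (x \<bullet> z)) / (1 + ln (f x) / s) powr s"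
proof -
  have "max (1 - x \<bullet> (z /\<^sub>R s)) 0 \<le> exp (- (x \<bullet> z) / s)"
    using exp_ge_add_one_self[of "- (x \<bullet> z) / s"] by (simp add: divide_inverse_commute)
  then have "max (1 - x \<bullet> (z /\<^sub>R s)) 0 powr s \<le> exp (- (x \<bullet> z) / s) powr s"
    using s by (intro powr_mono2) auto
  also have "\<dots> = exp (- (x \<bullet> z))"
    using s by (simp add: exp_powr_real)
  finally have "max (1 - x \<bullet> (z /\<^sub>R s)) 0 powr s / s_approx s f x
      \<le> exp (- (x \<bullet> z)) / s_approx s f x"
    using x by (intro divide_right_mono) (auto simp: supp_def)
  with s_polar_le[OF x, of s "z /\<^sub>R s"] show ?thesis
    by (simp add: s_approx_eq[OF s x])
qed

text \<open>
  The reciprocal quotient \<open>(1 + l / s) / (1 - t / s)\<close> equals \<open>1 + (l + t) / (s - t)\<close>, hence is at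
  most \<open>exp ((l + t) / (s - t))\<close>. The exponent that results is \<open>- l - t\<close>, that of the
  log-conjugate, distorted by the factor \<open>s / (s - t)\<close>.
\<close>

lemma exp_le_powr_quotient:
  fixes l t s :: real
  assumes "s > 0" "- s < l" "t < s"
  shows "exp ((- l - t) * s / (s - t)) \<le> (1 - t / s) powr s / (1 + l / s) powr s"
proof -
  define a where "a = 1 - t / s"
  define b where "b = 1 + l / s"
  define E where "E = (l + t) / (s - t)"
  have pos: "0 < a" "0 < b" using assms by (simp_all add: a_def b_def field_simps)
  have "b / a = 1 + E"
    using assms by (simp add: a_def b_def E_def field_simps)
  also have "\<dots> \<le> exp E" by (rule exp_ge_add_one_self)
  finally have "ln (b / a) \<le> E"
    using pos by (metis divide_pos_pos ln_exp ln_le_cancel_iff exp_gt_zero)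
  then have "ln b - ln a \<le> E"
    using pos by (simp add: ln_div)
  then have "s * (ln b - ln a) \<le> s * E"
    using assms(1) by (intro mult_left_mono) simp_all
  moreover have "(- l - t) * s / (s - t) = - (s * E)"
    using assms by (simp add: E_def field_simps)
  ultimately have "exp ((- l - t) * s / (s - t)) \<le> exp (s * ln a - s * ln b)"
    by (simp add: right_diff_distrib)
  also have "\<dots> = a powr s / b powr s"
    using pos by (simp add: exp_diff powr_def)
  finally show ?thesis unfolding a_def b_def .
qed

text \<open>
  Knowing the lower bound \<open>exp m\<close> on a ball, rather than only at \<open>z\<close>, makes \<open>- ln (f x) - x \<bullet> z\<close>
  grow linearly in \<open>norm x\<close>. With this growth, no far-away \<open>x\<close> can push the \<open>s\<close>-polar
  below \<open>exp m\<close>, and bounded and unbounded \<open>x\<close> need no separate treatment. The threshold on \<open>s\<close>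
  is chosen so that the growth outweighs the distortion \<open>s / (s - t)\<close> of \<open>exp_le_powr_quotient\<close>.
\<close>

lemma s_polar_scaled_ge:
  fixes f :: "'a::real_inner \<Rightarrow> real"
  assumes r: "r > 0" and L: "\<And>w. w \<in> cball z r \<Longrightarrow> exp m \<le> log_polar f w"
    and s: "s > 0" "s > \<bar>m\<bar> * norm z / r" and ne: "supp (s_approx s f) \<noteq> {}"
  shows "exp m \<le> s_polar s (s_approx s f) (z /\<^sub>R s)"
  unfolding s_polar_def
proof (rule cINF_greatest[OF ne])
  fix x assume x: "x \<in> supp (s_approx s f)"
  define l where "l = ln (f x)"
  define t where "t = x \<bullet> z"
  have xf: "x \<in> supp f" "f x > 0" and l: "- s < l"
    using x unfolding supp_s_approx[OF s(1)] by (simp_all add: l_def supp_def)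
  have t: "\<bar>t\<bar> \<le> norm x * norm z" unfolding t_def by (rule Cauchy_Schwarz_ineq2)
  have growth: "r * norm x + m \<le> - l - t"
  proof -
    \<comment> \<open>Moving the dual point by \<open>r\<close> in the direction of \<open>x\<close> gains \<open>r * norm x\<close>.\<close>
    have "z + r *\<^sub>R sgn x \<in> cball z r" using r by (simp add: dist_norm norm_sgn)
    from L[OF this] log_polar_le[OF xf(1)]
    have "exp m \<le> exp (- (x \<bullet> (z + r *\<^sub>R sgn x))) / f x" by (rule order_trans)
    also have "\<dots> = exp (- (x \<bullet> (z + r *\<^sub>R sgn x)) - l)"
      using xf by (simp add: exp_diff l_def)
    also have "x \<bullet> (z + r *\<^sub>R sgn x) = t + r * norm x"
      by (cases "x = 0") (simp_all add: t_def inner_add_right sgn_div_norm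
          power2_norm_eq_inner[symmetric] power2_eq_square)
    finally show ?thesis by simp
  qed
  have sr: "\<bar>m\<bar> * norm z \<le> r * s" using s r by (simp add: field_simps)
  \<comment> \<open>Where the growth bound is nonnegative, \<open>t\<close> is at most \<open>- l\<close>; elsewhere \<open>x\<close> is bounded.\<close>
  have ts: "t < s"
  proof (cases "0 \<le> r * norm x + m")
    case True
    then show ?thesis using growth l by linarith
  next
    case False
    then have "norm x \<le> \<bar>m\<bar> / r" using r by (simp add: field_simps)
    then have "norm x * norm z \<le> \<bar>m\<bar> / r * norm z" by (rule mult_right_mono) simp
    then show ?thesis using t s by simp
  qed
  have "- m * t \<le> \<bar>m\<bar> * \<bar>t\<bar>" by (metis abs_ge_minus_self abs_mult mult_minus_left)
  also have "\<dots> \<le> \<bar>m\<bar> * (norm x * norm z)" using t by (rule mult_left_mono) simp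
  also have "\<dots> \<le> r * norm x * s"
    using mult_left_mono[OF sr, of "norm x"] by (simp add: mult_ac)
  finally have "m * (s - t) \<le> (r * norm x + m) * s" by (simp add: algebra_simps)
  also have "\<dots> \<le> (- l - t) * s" using growth s by (intro mult_right_mono) auto
  finally have "m \<le> (- l - t) * s / (s - t)" using ts by (simp add: le_divide_eq)
  then have "exp m \<le> exp ((- l - t) * s / (s - t))" by simp
  also have "\<dots> \<le> (1 - t / s) powr s / (1 + l / s) powr s"
    using s l ts by (intro exp_le_powr_quotient)
  also have "1 - t / s = max (1 - x \<bullet> (z /\<^sub>R s)) 0"
    using s ts by (simp add: t_def divide_inverse_commute[symmetric] field_simps max_def)
  finally show "exp m \<le> max (1 - x \<bullet> (z /\<^sub>R s)) 0 powr s / s_approx s f x"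
    using s_approx_eq[OF s(1) x] by (simp add: l_def)
qed

section \<open>Convergence\<close>

lemma eventually_mem_supp_s_approx:
  assumes "x \<in> supp f"
  shows "\<forall>\<^sub>F s in at_top. x \<in> supp (s_approx s f)"
  using eventually_gt_at_top[of "max 0 (- ln (f x))"]
  by eventually_elim (use assms in \<open>simp add: supp_s_approx\<close>)

text \<open>
  The infimum defining the log-conjugate at \<open>y\<close> is nearly attained at some \<open>x\<close>, and this same \<open>x\<close>
  serves as test point for all dual points near \<open>y\<close> and all large \<open>s\<close>.
\<close>

lemma s_polar_scaled_locally_less:
  fixes f :: "'a::real_inner \<Rightarrow> real"
  assumes ne: "supp f \<noteq> {}" and c: "log_polar f y < c"
  shows "\<exists>U. open U \<and> y \<in> U \<and>
           (\<forall>\<^sub>F s in at_top. \<forall>z\<in>U. s_polar s (s_approx s f) (z /\<^sub>R s) < c)"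
proof -
  have "\<exists>x\<in>supp f. exp (- (x \<bullet> y)) / f x < c"
  proof (rule ccontr)
    assume "\<not> ?thesis"
    then have "c \<le> log_polar f y"
      unfolding log_polar_def by (intro cINF_greatest[OF ne]) (simp add: not_less)
    with c show False by simp
  qed
  then obtain x where x: "x \<in> supp f" "exp (- (x \<bullet> y)) / f x < c" by blast
  \<comment> \<open>\<open>b\<close> leaves room for moving the dual point on one side and for the limit in \<open>s\<close> on the other.\<close>
  obtain b where b: "exp (- (x \<bullet> y)) / f x < b / f x" "b / f x < c"
  proof -
    obtain d where "exp (- (x \<bullet> y)) / f x < d" "d < c" using dense[OF x(2)] by auto
    then show thesis using that[of "d * f x"] x(1) by (simp add: supp_def)
  qed
  have fx: "f x > 0" using x by (simp add: supp_def)
  define U where "U = {z. exp (- (x \<bullet> z)) < b}"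
  have "open U" unfolding U_def by (intro open_Collect_less continuous_intros)
  moreover have "y \<in> U" using b fx by (simp add: U_def divide_less_cancel)
  moreover have "\<forall>\<^sub>F s in at_top. \<forall>z\<in>U. s_polar s (s_approx s f) (z /\<^sub>R s) < c"
  proof -
    have "((\<lambda>s. b / (1 + ln (f x) / s) powr s) \<longlongrightarrow> b / exp (ln (f x))) at_top"
      by (intro tendsto_intros tendsto_exp_limit_at_top) simp
    then have "\<forall>\<^sub>F s in at_top. b / (1 + ln (f x) / s) powr s < c"
      using b fx by (intro order_tendstoD(2)) auto
    then show ?thesis
      using eventually_mem_supp_s_approx[OF x(1)] eventually_gt_at_top[of 0]
    proof eventually_elim
      case (elim s)
      show ?case
      proof
        fix z assume "z \<in> U"
        then have "exp (- (x \<bullet> z)) / (1 + ln (f x) / s) powr s \<le> b / (1 + ln (f x) / s) powr s"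
          by (intro divide_right_mono) (auto simp: U_def)
        with s_polar_scaled_le[OF elim(3,2), of z] elim(1)
        show "s_polar s (s_approx s f) (z /\<^sub>R s) < c" by linarith
      qed
    qed
  qed
  ultimately show ?thesis by blast
qed

text \<open>
  Continuity provides a level above \<open>c\<close> that the log-conjugate exceeds on a ball about \<open>y\<close>. Halving
  the radius leaves, around each point of the smaller ball, the room that \<open>s_polar_scaled_ge\<close> asks
  for, with one threshold on \<open>s\<close> for all these points.
\<close>

lemma s_polar_scaled_locally_greater:
  fixes f :: "'a::real_inner \<Rightarrow> real"
  assumes ne: "supp f \<noteq> {}" and cont: "isCont (log_polar f) y" and c: "c < log_polar f y"
  shows "\<exists>U. open U \<and> y \<in> U \<and>
           (\<forall>\<^sub>F s in at_top. \<forall>z\<in>U. c < s_polar s (s_approx s f) (z /\<^sub>R s))"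
proof -
  obtain x where x: "x \<in> supp f" using ne by blast
  show ?thesis
  proof (cases "c < 0")
    case True
    have "\<forall>\<^sub>F s in at_top. \<forall>z\<in>UNIV. c < s_polar s (s_approx s f) (z /\<^sub>R s)"
      using eventually_mem_supp_s_approx[OF x]
    proof eventually_elim
      case (elim s)
      then have "supp (s_approx s f) \<noteq> {}" by blast
      then show ?case using True by (blast intro: less_le_trans s_polar_nonneg)
    qed
    then show ?thesis by (intro exI[of _ UNIV]) simp
  next
    case False
    obtain b where b: "c < b" "b < log_polar f y" using dense[OF c] by auto
    define m where "m = ln b"
    have m: "exp m = b" using b False by (simp add: m_def)
    have "\<forall>\<^sub>F w in nhds y. b < log_polar f w"
      using cont b(2) by (intro order_tendstoD(1)[of _ "log_polar f y"])
        (auto simp: isCont_def tendsto_at_iff_tendsto_nhds)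
    then obtain q where q: "q > 0" "\<And>w. dist w y < q \<Longrightarrow> b < log_polar f w"
      by (auto simp: eventually_nhds_metric)
    define r where "r = q / 2"
    have r: "r > 0" using q by (simp add: r_def)
    have "\<forall>\<^sub>F s in at_top. \<forall>z\<in>ball y r. c < s_polar s (s_approx s f) (z /\<^sub>R s)"
      using eventually_mem_supp_s_approx[OF x] eventually_gt_at_top[of 0]
        eventually_gt_at_top[of "\<bar>m\<bar> * (norm y + r) / r"]
    proof eventually_elim
      case (elim s)
      show ?case
      proof
        fix z assume z: "z \<in> ball y r"
        have "exp m \<le> log_polar f w" if "w \<in> cball z r" for w
        proof -
          have "dist w y < q"
            using that z dist_triangle[of w y z] by (simp add: r_def dist_commute)
          then show ?thesis using q(2) m by (simp add: less_imp_le)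
        qed
        moreover have "\<bar>m\<bar> * norm z / r < s"
        proof -
          have "norm z \<le> norm y + r"
            using z norm_triangle_ineq2[of z y] by (simp add: dist_norm norm_minus_commute)
          then have "\<bar>m\<bar> * norm z / r \<le> \<bar>m\<bar> * (norm y + r) / r"
            using r by (intro divide_right_mono mult_left_mono) auto
          then show ?thesis using elim by linarith
        qed
        ultimately have "exp m \<le> s_polar s (s_approx s f) (z /\<^sub>R s)"
          using r elim by (intro s_polar_scaled_ge) auto
        then show "c < s_polar s (s_approx s f) (z /\<^sub>R s)" using b m by simp
      qed
    qed
    then show ?thesis using r by (intro exI[of _ "ball y r"]) simp
  qed
qed

text \<open>
  One-sided estimates at \<open>y\<close> compare \<open>h i z\<close> with \<open>l y\<close>; continuity of \<open>l\<close> replaces \<open>l y\<close> by \<open>l z\<close>.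
  The neighbourhood obtained in this way depends on the tolerance \<open>e\<close>, whereas local uniformity
  asks for one neighbourhood for all tolerances: a closed ball inside \<open>A\<close> works, being covered by
  finitely many of the neighbourhoods for each \<open>e\<close>.
\<close>

lemma locally_uniform_limitI:
  fixes h :: "'i \<Rightarrow> 'a::heine_borel \<Rightarrow> real"
  assumes A: "open A" and cont: "\<And>y. y \<in> A \<Longrightarrow> isCont l y"
    and less: "\<And>y c. y \<in> A \<Longrightarrow> l y < c \<Longrightarrow>
      \<exists>U. open U \<and> y \<in> U \<and> (\<forall>\<^sub>F i in F. \<forall>z\<in>U. h i z < c)"
    and greater: "\<And>y c. y \<in> A \<Longrightarrow> c < l y \<Longrightarrow>
      \<exists>U. open U \<and> y \<in> U \<and> (\<forall>\<^sub>F i in F. \<forall>z\<in>U. c < h i z)"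
  shows "locally_uniform_limit A h l F"
proof -
  have near: "\<exists>U. open U \<and> y \<in> U \<and> (\<forall>\<^sub>F i in F. \<forall>z\<in>U. dist (h i z) (l z) < e)"
    if y: "y \<in> A" and e: "e > 0" for y e
  proof -
    obtain U where U: "open U" "y \<in> U" "\<forall>\<^sub>F i in F. \<forall>z\<in>U. h i z < l y + e / 2"
      using less[OF y, of "l y + e / 2"] e by auto
    obtain V where V: "open V" "y \<in> V" "\<forall>\<^sub>F i in F. \<forall>z\<in>V. l y - e / 2 < h i z"
      using greater[OF y, of "l y - e / 2"] e by auto
    have "\<forall>\<^sub>F z in nhds y. dist (l z) (l y) < e / 2"
      using cont[OF y] e by (intro tendstoD) (auto simp: isCont_def tendsto_at_iff_tendsto_nhds)
    then obtain W where W: "open W" "y \<in> W" "\<And>z. z \<in> W \<Longrightarrow> dist (l z) (l y) < e / 2"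
      by (auto simp: eventually_nhds)
    have "\<forall>\<^sub>F i in F. \<forall>z\<in>U \<inter> V \<inter> W. dist (h i z) (l z) < e"
      using U(3) V(3)
    proof eventually_elim
      case (elim i)
      show ?case
      proof
        fix z assume z: "z \<in> U \<inter> V \<inter> W"
        then have "h i z < l y + e / 2" "l y - e / 2 < h i z" "\<bar>l z - l y\<bar> < e / 2"
          using elim W(3)[of z] by (auto simp: dist_real_def)
        then show "dist (h i z) (l z) < e" unfolding dist_real_def by linarith
      qed
    qed
    then show ?thesis using U V W by (intro exI[of _ "U \<inter> V \<inter> W"]) auto
  qed
  show ?thesis
    unfolding locally_uniform_limit_def
  proof
    fix y assume "y \<in> A"
    then obtain r where r: "r > 0" "cball y r \<subseteq> A"
      using A open_contains_cball by blast
    have "uniform_limit (cball y r) h l F"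
      unfolding uniform_limit_iff
    proof (intro allI impI)
      fix e :: real assume e: "e > 0"
      define G where "G = {U. open U \<and> (\<forall>\<^sub>F i in F. \<forall>z\<in>U. dist (h i z) (l z) < e)}"
      have "cball y r \<subseteq> \<Union>G"
      proof
        fix z assume "z \<in> cball y r"
        then have "z \<in> A" using r(2) by blast
        from near[OF this e] show "z \<in> \<Union>G" unfolding G_def by blast
      qed
      moreover have "\<And>U. U \<in> G \<Longrightarrow> open U" by (simp add: G_def)
      ultimately obtain T where T: "T \<subseteq> G" "finite T" "cball y r \<subseteq> \<Union>T"
        using compactE[OF compact_cball] by metis
      have "\<forall>\<^sub>F i in F. \<forall>U\<in>T. \<forall>z\<in>U. dist (h i z) (l z) < e"
        using T by (subst eventually_ball_finite_distrib) (auto simp: G_def)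
      then show "\<forall>\<^sub>F i in F. \<forall>z\<in>cball y r. dist (h i z) (l z) < e"
        by eventually_elim (use T(3) in blast)
    qed
    then have "uniform_limit (ball y r \<inter> A) h l F"
      by (rule uniform_limit_on_subset) auto
    then show "\<exists>U. open U \<and> y \<in> U \<and> uniform_limit (U \<inter> A) h l F"
      using r by (intro exI[of _ "ball y r"]) simp
  qed
qed

theorem theorem3:
  fixes f :: "real ^ 'n \<Rightarrow> real"
  assumes "upper_semicontinuous f"
    and "logconcave f"
    and "integrable lborel f"
    and "0 \<in> interior (supp f)"
  shows "locally_uniform_limit (- frontier (supp (log_polar f)))
           (\<lambda>s x. s_polar s (s_approx s f) (x /\<^sub>R s)) (log_polar f) at_top"
proof (rule locally_uniform_limitI)
  have ne: "supp f \<noteq> {}" using assms(4) interior_subset by blast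
  show "open (- frontier (supp (log_polar f)))" by (simp add: open_Compl)
  fix y assume y: "y \<in> - frontier (supp (log_polar f))"
  show "isCont (log_polar f) y" by (rule isCont_log_polar[OF ne y])
  then show "\<exists>U. open U \<and> y \<in> U \<and>
      (\<forall>\<^sub>F s in at_top. \<forall>z\<in>U. c < s_polar s (s_approx s f) (z /\<^sub>R s))"
    if "c < log_polar f y" for c
    using s_polar_scaled_locally_greater[OF ne] that by blast
  show "\<exists>U. open U \<and> y \<in> U \<and>
      (\<forall>\<^sub>F s in at_top. \<forall>z\<in>U. s_polar s (s_approx s f) (z /\<^sub>R s) < c)"
    if "log_polar f y < c" for c
    using s_polar_scaled_locally_less[OF ne that] .
qed

end
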